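(* Let $\psi\in[0,1]$ and $n\in\mathbb{N}$, and let $\mu$ be the probability measure over $[0,1]^n$ that is the law of $(x_1,\dots,x_n)$ generated as follows: sample $x^*$ uniformly from $[0,1]$; then, independently for every $i\in[n]$, sample $\sigma_i\sim\mathrm{Ber}(\psi)$, and set $x_i=x^*$ if $\sigma_i=1$, and otherwise sample $x_i$ uniformly from $[0,1]$ (independently of everything else). Then $\mu$ has $\psi$-Gibbs dependence, i.e. $\psi(\mu)\le\psi$.
   Context: For a probability measure $\mu$ over $\mathcal{X}^n$, $$\psi(\mu)=\sup_{x\in\mathcal{X}^n}\ \mathbb{E}_{i\sim[n]}\left\|\mu_i(\cdot)-\mu_i(\cdot\mid x^{-i})\right\|_{TV},$$ where $i$ is uniform on $[n]$, $\mu_i$ is the $i$-th marginal, $\mu_i(\cdot\mid x^{-i})$ is the conditional distribution (a suitable version of the regular conditional probability) of the $i$-th coordinate given that all other coordinates equal those of $x$, and $\|\cdot\|_{TV}$ is total variation distance. $\mu$ has $\psi$-Gibbs dependence if $\psi(\mu)\le\psi$. $\mathrm{Ber}(\psi)$ is the Bernoulli distribution on $\{0,1\}$ with mean $\psi$. *)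

theory Defs
  imports "HOL-Probability.Probability"
begin

text \<open>
  The space \<open>X^n\<close> is \<open>PiM {1..n} (\<lambda>_. M)\<close>, where only the measurable structure of \<open>M\<close> matters.
\<close>

abbreviation pow_space :: "'a measure \<Rightarrow> nat \<Rightarrow> (nat \<Rightarrow> 'a) measure" where
  "pow_space M n \<equiv> PiM {1..n} (\<lambda>_. M)"

text \<open>
  Total variation distance in the normalization with values in \<open>[0,1]\<close>; meant for probability
  measures \<open>P\<close>, \<open>Q\<close> on the same \<open>\<sigma>\<close>-algebra, for which the supremum is over a bounded set.
\<close>

definition tv_dist :: "'a measure \<Rightarrow> 'a measure \<Rightarrow> real" where
  "tv_dist P Q = (SUP A\<in>sets P. \<bar>measure P A - measure Q A\<bar>)"

definition marginal :: "'a measure \<Rightarrow> (nat \<Rightarrow> 'a) measure \<Rightarrow> nat \<Rightarrow> 'a measure" where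
  "marginal M \<mu> i = distr \<mu> M (\<lambda>x. x i)"

definition drop_coord :: "nat \<Rightarrow> nat \<Rightarrow> (nat \<Rightarrow> 'a) \<Rightarrow> (nat \<Rightarrow> 'a)" where
  "drop_coord n i x = restrict x ({1..n} - {i})"

text \<open>
  \<open>\<kappa>\<close> is a version of the regular conditional distribution of the \<open>i\<close>-th coordinate given all the
  others, under \<open>\<mu>\<close>: a Markov kernel (defined at every point, not just almost everywhere) that
  disintegrates \<open>\<mu>\<close>.
\<close>

definition cond_version ::
    "'a measure \<Rightarrow> nat \<Rightarrow> (nat \<Rightarrow> 'a) measure \<Rightarrow> nat \<Rightarrow> ((nat \<Rightarrow> 'a) \<Rightarrow> 'a measure) \<Rightarrow> bool" where
  "cond_version M n \<mu> i \<kappa> \<longleftrightarrow>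
     \<kappa> \<in> measurable (PiM ({1..n} - {i}) (\<lambda>_. M)) (prob_algebra M) \<and>
     (\<forall>A \<in> sets (PiM ({1..n} - {i}) (\<lambda>_. M)). \<forall>B \<in> sets M.
        emeasure \<mu> {x \<in> space \<mu>. drop_coord n i x \<in> A \<and> x i \<in> B} =
        (\<integral>\<^sup>+x. indicator A (drop_coord n i x) * emeasure (\<kappa> (drop_coord n i x)) B \<partial>\<mu>))"

text \<open>
  The value \<open>\<psi>(\<mu>)\<close> computed from the versions \<open>\<kappa> i\<close> of the conditional distributions. The supremum
  is over every point of \<open>X^n\<close>, so it depends on the choice of the versions.
\<close>

definition gibbs_coeff ::
    "'a measure \<Rightarrow> nat \<Rightarrow> (nat \<Rightarrow> 'a) measure \<Rightarrow> (nat \<Rightarrow> (nat \<Rightarrow> 'a) \<Rightarrow> 'a measure) \<Rightarrow> real" where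
  "gibbs_coeff M n \<mu> \<kappa> =
     (SUP x\<in>space (pow_space M n).
        measure_pmf.expectation (pmf_of_set {1..n})
          (\<lambda>i. tv_dist (marginal M \<mu> i) (\<kappa> i (drop_coord n i x))))"

text \<open>
  The existential quantifier is the ``suitable version of the regular conditional probability''.
\<close>

definition gibbs_dependence :: "'a measure \<Rightarrow> nat \<Rightarrow> (nat \<Rightarrow> 'a) measure \<Rightarrow> real \<Rightarrow> bool" where
  "gibbs_dependence M n \<mu> \<psi> \<longleftrightarrow>
     \<mu> \<in> space (prob_algebra (pow_space M n)) \<and>
     (\<exists>\<kappa>. (\<forall>i\<in>{1..n}. cond_version M n \<mu> i (\<kappa> i)) \<and> gibbs_coeff M n \<mu> \<kappa> \<le> \<psi>)"

definition unit_interval :: "real measure" where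
  "unit_interval = restrict_space borel {0..1}"

definition unif :: "real measure" where
  "unif = restrict_space lborel {0..1}"

text \<open>
  The sample space carries \<open>x\<^sup>*\<close> and, independently for each \<open>i\<close>, a pair of a \<open>Ber(\<psi>)\<close> variable
  \<open>\<sigma>\<^sub>i\<close> (with \<open>True\<close> for \<open>1\<close>) and a uniform variable, which is discarded when \<open>\<sigma>\<^sub>i = 1\<close>.
\<close>

definition mixture_law :: "nat \<Rightarrow> real \<Rightarrow> (nat \<Rightarrow> real) measure" where
  "mixture_law n \<psi> =
     distr (unif \<Otimes>\<^sub>M PiM {1..n} (\<lambda>_. measure_pmf (bernoulli_pmf \<psi>) \<Otimes>\<^sub>M unif))
       (pow_space unit_interval n)
       (\<lambda>(xstar, \<omega>). \<lambda>i\<in>{1..n}. if fst (\<omega> i) then xstar else snd (\<omega> i))"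

end

theory Submission
  imports Defs
begin

text \<open>
  Given the other coordinates, \<open>x\<^sub>i\<close> has the law \<open>\<psi> \<rho> + (1 - \<psi>) U\<close>, where \<open>U\<close> is the uniform
  law and \<open>\<rho>\<close> is the conditional law of \<open>x\<^sup>*\<close> given the other coordinates. The marginal is \<open>U\<close>, so
  the total variation distance is \<open>\<psi>\<close> times the distance of \<open>U\<close> and \<open>\<rho>\<close>, hence at most \<open>\<psi>\<close> at
  every point.
\<close>

section \<open>Finite mixtures of Markov kernels and disintegration over a finite partition\<close>

text \<open>Drawing an index \<open>j\<close> with weight \<open>w j y\<close> and then a point from
  \<open>R j y\<close> is a composition of measures, so countable additivity comes from
  \<open>bind\<close>, and total mass 1 at every point from \<open>sum1\<close>. Used below both
  with weights depending on \<open>y\<close> and with the constant weights \<psi> and 1 -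
  \<psi>.\<close>

lemma kernel_finite_mixture:
  assumes fin: "finite K"
    and w: "\<And>j. j \<in> K \<Longrightarrow> w j \<in> borel_measurable N"
    and R: "\<And>j. j \<in> K \<Longrightarrow> R j \<in> measurable N (prob_algebra M)"
    and sum1: "\<And>y. y \<in> space N \<Longrightarrow> (\<Sum>j\<in>K. w j y) = (1::ennreal)"
  obtains \<kappa> where "\<kappa> \<in> measurable N (prob_algebra M)"
    and "\<And>y B. y \<in> space N \<Longrightarrow> B \<in> sets M \<Longrightarrow>
           emeasure (\<kappa> y) B = (\<Sum>j\<in>K. w j y * emeasure (R j y) B)"
proof -
  define \<kappa> where "\<kappa> y = density (count_space K) (\<lambda>j. w j y) \<bind> (\<lambda>j. R j y)" for y
  have Rp: "R j y \<in> space (prob_algebra M)" if "j \<in> K" "y \<in> space N" for j y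
    using measurable_space[OF R that(2)] that(1) by auto
  have Rs: "sets (R j y) = sets M" "prob_space (R j y)" if "j \<in> K" "y \<in> space N" for j y
    using Rp[OF that] by (auto simp: space_prob_algebra)
  \<comment> \<open>An empty sum would be 0, not 1. Nonemptiness matters because \<open>bind\<close>
    over an empty space takes the degenerate value \<open>count_space {}\<close>.\<close>
  have K: "K \<noteq> {}" if "y \<in> space N" for y
    using sum1[OF that] by auto
  have meas: "(\<lambda>j. R j y) \<in> measurable (density (count_space K) (\<lambda>j. w j y)) (subprob_algebra M)"
    if "y \<in> space N" for y
    using Rs that by (auto simp: space_subprob_algebra prob_space_imp_subprob_space)
  have em: "emeasure (\<kappa> y) B = (\<Sum>j\<in>K. w j y * emeasure (R j y) B)"
    if y: "y \<in> space N" and B: "B \<in> sets M" for y B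
  proof -
    have "emeasure (\<kappa> y) B = (\<integral>\<^sup>+j. emeasure (R j y) B \<partial>density (count_space K) (\<lambda>j. w j y))"
      unfolding \<kappa>_def using K[OF y] B meas[OF y] by (intro emeasure_bind) auto
    also have "\<dots> = (\<Sum>j\<in>K. w j y * emeasure (R j y) B)"
      using fin by (simp add: nn_integral_density nn_integral_count_space_finite)
    finally show ?thesis .
  qed
  have sets: "sets (\<kappa> y) = sets M" if "y \<in> space N" for y
    unfolding \<kappa>_def using K[OF that] Rs(1) that by (intro sets_bind) auto
  have prob: "prob_space (\<kappa> y)" if y: "y \<in> space N" for y
  proof
    have "emeasure (R j y) (space M) = 1" if "j \<in> K" for j
      using prob_space.emeasure_space_1[OF Rs(2)[OF that y]] sets_eq_imp_space_eq[OF Rs(1)[OF that y]]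
      by simp
    then show "emeasure (\<kappa> y) (space (\<kappa> y)) = 1"
      using em[OF y sets.top] sum1[OF y] sets_eq_imp_space_eq[OF sets[OF y]] by simp
  qed
  have "\<kappa> \<in> measurable N (prob_algebra M)"
  proof (intro measurable_prob_algebraI measurable_subprob_algebra)
    fix B assume B: "B \<in> sets M"
    have "(\<lambda>y. \<Sum>j\<in>K. w j y * emeasure (R j y) B) \<in> borel_measurable N"
      using w measurable_emeasure_kernel[OF measurable_prob_algebraD[OF R] B]
      by (intro borel_measurable_sum borel_measurable_times) auto
    then show "(\<lambda>y. emeasure (\<kappa> y) B) \<in> borel_measurable N"
      using em B by (simp cong: measurable_cong)
  qed (use prob sets prob_space_imp_subprob_space in auto)
  then show thesis using em that by blast
qed

text \<open>
  The kernel weighs \<open>R j\<close> by the conditional probability of \<open>E j\<close> given \<open>Y\<close>, obtained as a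
  Radon--Nikodym derivative.
\<close>

lemma disintegration_finite_partition:
  assumes P: "prob_space P"
    and Y [measurable]: "Y \<in> measurable P N"
    and X [measurable]: "X \<in> measurable P M"
    and fin: "finite K"
    and E: "\<And>j. j \<in> K \<Longrightarrow> E j \<in> sets P"
    and part: "\<And>\<omega>. \<omega> \<in> space P \<Longrightarrow> (\<Sum>j\<in>K. indicator (E j) \<omega>) = (1::ennreal)"
    and R: "\<And>j. j \<in> K \<Longrightarrow> R j \<in> measurable N (prob_algebra M)"
    and dis: "\<And>j A B. j \<in> K \<Longrightarrow> A \<in> sets N \<Longrightarrow> B \<in> sets M \<Longrightarrow>
       (\<integral>\<^sup>+\<omega>. indicator (E j) \<omega> * (indicator A (Y \<omega>) * indicator B (X \<omega>)) \<partial>P) =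
       (\<integral>\<^sup>+\<omega>. indicator (E j) \<omega> * (indicator A (Y \<omega>) * emeasure (R j (Y \<omega>)) B) \<partial>P)"
  obtains \<rho> where "\<rho> \<in> measurable N (prob_algebra M)"
    and "\<And>A B. A \<in> sets N \<Longrightarrow> B \<in> sets M \<Longrightarrow>
       (\<integral>\<^sup>+\<omega>. indicator A (Y \<omega>) * indicator B (X \<omega>) \<partial>P) =
       (\<integral>\<^sup>+\<omega>. indicator A (Y \<omega>) * emeasure (\<rho> (Y \<omega>)) B \<partial>P)"
proof -
  interpret prob_space P by (rule P)
  define \<nu> where "\<nu> = distr P N Y"
  \<comment> \<open>\<open>\<nu>' j\<close> is the part of the law of \<open>Y\<close> coming from
    the event \<open>E j\<close>; its density \<open>f j\<close> with respect to
    \<open>\<nu>\<close> is the conditional probability of \<open>E j\<close> given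
    \<open>Y = y\<close>.\<close>
  define \<nu>' where "\<nu>' j = distr (density P (indicator (E j))) N Y" for j
  define f where "f j = RN_deriv \<nu> (\<nu>' j)" for j
  interpret \<nu>: prob_space \<nu> unfolding \<nu>_def by (rule prob_space_distr) measurable
  have sets_\<nu> [measurable_cong]: "sets \<nu> = sets N" by (simp add: \<nu>_def)
  have sets_\<nu>' [measurable_cong]: "sets (\<nu>' j) = sets N" for j by (simp add: \<nu>'_def)
  have f_meas [measurable]: "f j \<in> borel_measurable N" for j
    using borel_measurable_RN_deriv[of \<nu> "\<nu>' j"] by (simp add: f_def cong: measurable_cong_sets)
  have int_\<nu>': "(\<integral>\<^sup>+y. h y \<partial>\<nu>' j) = (\<integral>\<^sup>+\<omega>. indicator (E j) \<omega> * h (Y \<omega>) \<partial>P)"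
    if "j \<in> K" and [measurable]: "h \<in> borel_measurable N" for j h
  proof -
    note [measurable] = E[OF that(1)]
    show ?thesis unfolding \<nu>'_def by (simp add: nn_integral_distr nn_integral_density)
  qed
  have dens: "density \<nu> (f j) = \<nu>' j" if "j \<in> K" for j
  proof -
    note [measurable] = E[OF that]
    \<comment> \<open>A \<open>\<nu>\<close>-null set has a \<open>P\<close>-null preimage under
      \<open>Y\<close>, which stays null for \<open>P\<close> restricted to
      \<open>E j\<close>.\<close>
    have "absolutely_continuous \<nu> (\<nu>' j)"
      unfolding absolutely_continuous_def
    proof
      fix A assume A: "A \<in> null_sets \<nu>"
      then have [measurable]: "A \<in> sets N" and "emeasure \<nu> A = 0" by (auto simp: sets_\<nu>)
      then have 0: "emeasure P (Y -` A \<inter> space P) = 0" by (simp add: \<nu>_def emeasure_distr)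
      have "emeasure (\<nu>' j) A = emeasure (density P (indicator (E j))) (Y -` A \<inter> space P)"
        by (simp add: \<nu>'_def emeasure_distr)
      also have "\<dots> = 0"
        using absolutely_continuousI_density[of "indicator (E j)" P] 0
        by (auto simp: absolutely_continuous_def null_sets_def subset_iff)
      finally show "A \<in> null_sets (\<nu>' j)" by (auto simp: sets_\<nu>')
    qed
    then show ?thesis
      unfolding f_def by (intro \<nu>.density_RN_deriv) (auto simp: sets_\<nu> sets_\<nu>')
  qed
  \<comment> \<open>The defining property of conditional probability: weighting by
    \<open>f j\<close> under the law of \<open>Y\<close> is the same as restricting to
    \<open>E j\<close> under \<open>P\<close>.\<close>
  have int_f: "(\<integral>\<^sup>+y. f j y * h y \<partial>\<nu>) = (\<integral>\<^sup>+\<omega>. indicator (E j) \<omega> * h (Y \<omega>) \<partial>P)"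
    if "j \<in> K" and [measurable]: "h \<in> borel_measurable N" for j h
    by (simp add: int_\<nu>'[symmetric] that dens[symmetric] nn_integral_density)
  have split: "(\<integral>\<^sup>+\<omega>. h \<omega> \<partial>P) = (\<Sum>j\<in>K. \<integral>\<^sup>+\<omega>. indicator (E j) \<omega> * h \<omega> \<partial>P)"
    if [measurable]: "h \<in> borel_measurable P" for h
  proof -
    have "(\<integral>\<^sup>+\<omega>. h \<omega> \<partial>P) = (\<integral>\<^sup>+\<omega>. (\<Sum>j\<in>K. indicator (E j) \<omega> * h \<omega>) \<partial>P)"
      by (intro nn_integral_cong) (simp add: sum_distrib_right[symmetric] part)
    also have "\<dots> = (\<Sum>j\<in>K. \<integral>\<^sup>+\<omega>. indicator (E j) \<omega> * h \<omega> \<partial>P)"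
      using E by (intro nn_integral_sum) auto
    finally show ?thesis .
  qed
  \<comment> \<open>The pieces of the partition together recover \<open>\<nu>\<close>, so the sum of
    their densities and the constant 1 are densities of the same measure; uniqueness holds only
    almost everywhere.\<close>
  have "AE y in \<nu>. (\<Sum>j\<in>K. f j y) = 1"
  proof (rule \<nu>.density_unique)
    show "density \<nu> (\<lambda>y. \<Sum>j\<in>K. f j y) = density \<nu> (\<lambda>_. 1)"
    proof (rule measure_eqI)
      fix A assume "A \<in> sets (density \<nu> (\<lambda>y. \<Sum>j\<in>K. f j y))"
      then have [measurable]: "A \<in> sets N" by (simp add: sets_\<nu>)
      have "emeasure (density \<nu> (\<lambda>y. \<Sum>j\<in>K. f j y)) A = (\<Sum>j\<in>K. \<integral>\<^sup>+y. f j y * indicator A y \<partial>\<nu>)"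
        by (simp add: emeasure_density sum_distrib_right nn_integral_sum)
      also have "\<dots> = (\<integral>\<^sup>+\<omega>. indicator A (Y \<omega>) \<partial>P)"
        by (simp add: int_f split)
      also have "\<dots> = emeasure (density \<nu> (\<lambda>_. 1)) A"
        by (simp add: emeasure_density \<nu>_def nn_integral_distr del: nn_integral_indicator)
      finally show "emeasure (density \<nu> (\<lambda>y. \<Sum>j\<in>K. f j y)) A = emeasure (density \<nu> (\<lambda>_. 1)) A" .
    qed simp
  qed measurable
  obtain \<omega>\<^sub>0 where "\<omega>\<^sub>0 \<in> space P" using not_empty by blast
  then have "K \<noteq> {}" using part by force
  then obtain j\<^sub>0 where j\<^sub>0: "j\<^sub>0 \<in> K" by blast
  \<comment> \<open>The kernel has to be Markov at every point, but the derivatives add up to 1 only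
    almost everywhere. On the exceptional null set all the weight goes to the arbitrary index
    \<open>j\<^sub>0\<close>.\<close>
  define w where "w j y = (if (\<Sum>j\<in>K. f j y) = 1 then f j y else if j = j\<^sub>0 then 1 else 0)" for j y
  have sum_w: "(\<Sum>j\<in>K. w j y) = 1" for y
    using fin j\<^sub>0 by (cases "(\<Sum>j\<in>K. f j y) = 1") (simp_all add: w_def)
  have w_meas [measurable]: "w j \<in> borel_measurable N" for j
    unfolding w_def by measurable
  obtain \<rho> where \<rho>: "\<rho> \<in> measurable N (prob_algebra M)"
    and em: "\<And>y B. y \<in> space N \<Longrightarrow> B \<in> sets M \<Longrightarrow>
           emeasure (\<rho> y) B = (\<Sum>j\<in>K. w j y * emeasure (R j y) B)"
    using kernel_finite_mixture[of K w N R M] fin w_meas R sum_w by blast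
  show thesis
  proof (rule that[OF \<rho>])
    fix A B assume [measurable]: "A \<in> sets N" and B [measurable]: "B \<in> sets M"
    have R_meas: "(\<lambda>y. emeasure (R j y) B) \<in> borel_measurable N" if "j \<in> K" for j
      using measurable_emeasure_kernel[OF measurable_prob_algebraD[OF R[OF that]] B] .
    have [measurable]: "(\<lambda>y. emeasure (\<rho> y) B) \<in> borel_measurable N"
      using measurable_emeasure_kernel[OF measurable_prob_algebraD[OF \<rho>] B] .
    \<comment> \<open>On each piece \<open>dis\<close> replaces \<open>X\<close> by its kernel
      \<open>R j\<close>; then \<open>int_f\<close> moves the integrals to the law of
      \<open>Y\<close>, where they are summed.\<close>
    have "(\<integral>\<^sup>+\<omega>. indicator A (Y \<omega>) * indicator B (X \<omega>) \<partial>P) =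
      (\<Sum>j\<in>K. \<integral>\<^sup>+\<omega>. indicator (E j) \<omega> * (indicator A (Y \<omega>) * emeasure (R j (Y \<omega>)) B) \<partial>P)"
      by (simp add: split dis)
    also have "\<dots> = (\<Sum>j\<in>K. \<integral>\<^sup>+y. f j y * (indicator A y * emeasure (R j y) B) \<partial>\<nu>)"
      using R_meas by (intro sum.cong refl int_f[symmetric]) auto
    also have "\<dots> = (\<integral>\<^sup>+y. (\<Sum>j\<in>K. f j y * (indicator A y * emeasure (R j y) B)) \<partial>\<nu>)"
      using R_meas by (intro nn_integral_sum[symmetric]) (auto simp: measurable_cong_sets[OF sets_\<nu> refl])
    \<comment> \<open>Where the derivatives add up to 1, \<open>w\<close> coincides with
      \<open>f\<close>, so the change on the null set is invisible to the integral.\<close>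
    also have "\<dots> = (\<integral>\<^sup>+y. indicator A y * emeasure (\<rho> y) B \<partial>\<nu>)"
    proof (intro nn_integral_cong_AE, use \<open>AE y in \<nu>. (\<Sum>j\<in>K. f j y) = 1\<close> AE_space in eventually_elim)
      fix y assume "(\<Sum>j\<in>K. f j y) = 1" "y \<in> space \<nu>"
      then show "(\<Sum>j\<in>K. f j y * (indicator A y * emeasure (R j y) B)) = indicator A y * emeasure (\<rho> y) B"
        using em[of y B] sets_eq_imp_space_eq[OF sets_\<nu>] B
        by (simp add: w_def sum_distrib_left mult.left_commute)
    qed
    also have "\<dots> = (\<integral>\<^sup>+\<omega>. indicator A (Y \<omega>) * emeasure (\<rho> (Y \<omega>)) B \<partial>P)"
      unfolding \<nu>_def by (intro nn_integral_distr) measurable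
    finally show "(\<integral>\<^sup>+\<omega>. indicator A (Y \<omega>) * indicator B (X \<omega>) \<partial>P) =
       (\<integral>\<^sup>+\<omega>. indicator A (Y \<omega>) * emeasure (\<rho> (Y \<omega>)) B \<partial>P)" .
  qed
qed

section \<open>The sample space of the mixture and integration over a single site\<close>

lemma sets_unif [measurable_cong]: "sets unif = sets unit_interval"
  unfolding unif_def unit_interval_def by (intro sets_restrict_space_cong) simp

lemma space_unif: "space unif = {0..1}"
  by (simp add: unif_def space_restrict_space)

lemma prob_space_unif: "prob_space unif"
  by standard (simp add: space_unif, simp add: unif_def emeasure_restrict_space)

lemma unif_in_prob_algebra: "unif \<in> space (prob_algebra unit_interval)"
  by (simp add: space_prob_algebra sets_unif prob_space_unif)

abbreviation site :: "real \<Rightarrow> (bool \<times> real) measure" where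
  "site \<psi> \<equiv> measure_pmf (bernoulli_pmf \<psi>) \<Otimes>\<^sub>M unif"

abbreviation pick :: "real \<Rightarrow> bool \<times> real \<Rightarrow> real" where
  "pick x q \<equiv> if fst q then x else snd q"

text \<open>The index set is a parameter because the same space is needed with all the sites of
  \<open>{1..n}\<close> and with site \<open>i\<close> removed.\<close>

definition sites :: "nat set \<Rightarrow> real \<Rightarrow> (real \<times> (nat \<Rightarrow> bool \<times> real)) measure" where
  "sites I \<psi> = unif \<Otimes>\<^sub>M PiM I (\<lambda>_. site \<psi>)"

definition picks :: "nat set \<Rightarrow> real \<times> (nat \<Rightarrow> bool \<times> real) \<Rightarrow> nat \<Rightarrow> real" where
  "picks I p = (\<lambda>j\<in>I. pick (fst p) (snd p j))"

lemma prob_space_site: "prob_space (site \<psi>)"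
  by (intro prob_space_pair measure_pmf.prob_space_axioms prob_space_unif)

lemma prob_space_sites: "prob_space (sites I \<psi>)"
  unfolding sites_def by (intro prob_space_pair prob_space_unif prob_space_PiM prob_space_site)

lemma measurable_picks [measurable]:
  "picks I \<in> measurable (sites I \<psi>) (PiM I (\<lambda>_. unit_interval))"
  unfolding picks_def sites_def by measurable

lemma mixture_law_eq: "mixture_law n \<psi> = distr (sites {1..n} \<psi>) (pow_space unit_interval n) (picks {1..n})"
  unfolding mixture_law_def sites_def picks_def case_prod_beta ..

lemma sets_mixture_law [measurable_cong]: "sets (mixture_law n \<psi>) = sets (pow_space unit_interval n)"
  by (simp add: mixture_law_eq)

text \<open>Fubini over the coin and the fresh value: with \<open>x\<^sup>*\<close> frozen at
  \<open>x\<close>, heads returns \<open>x\<close> and tails returns the fresh uniform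
  value.\<close>

lemma nn_integral_pick:
  assumes \<psi>: "0 \<le> \<psi>" "\<psi> \<le> 1" and B [measurable]: "B \<in> sets unit_interval"
    and x: "x \<in> space unif"
  shows "(\<integral>\<^sup>+q. indicator B (pick x q) \<partial>site \<psi>) = ennreal \<psi> * indicator B x + ennreal (1 - \<psi>) * emeasure unif B"
proof -
  interpret U: prob_space unif by (rule prob_space_unif)
  have [measurable]: "x \<in> space unit_interval" using x sets_eq_imp_space_eq[OF sets_unif] by simp
  have "(\<integral>\<^sup>+q. indicator B (pick x q) \<partial>site \<psi>) =
    (\<integral>\<^sup>+b. \<integral>\<^sup>+u. indicator B (if b then x else u) \<partial>unif \<partial>measure_pmf (bernoulli_pmf \<psi>))"
    by (subst U.nn_integral_fst[symmetric]) (simp_all cong: if_cong)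
  also have "\<dots> = ennreal \<psi> * indicator B x + ennreal (1 - \<psi>) * emeasure unif B"
    using \<psi> B by (simp add: nn_integral_bernoulli_pmf U.emeasure_space_1 mult.commute sets_unif)
  finally show ?thesis .
qed

text \<open>Site \<open>i\<close> is independent of \<open>x\<^sup>*\<close> and of the other sites,
  so by Fubini it can be integrated innermost, with everything else fixed. Both the marginal and the
  conditional law of coordinate \<open>i\<close> are computed from this formula.\<close>

lemma nn_integral_mixture_law:
  assumes i: "i \<in> {1..n}" and g [measurable]: "g \<in> borel_measurable (pow_space unit_interval n)"
  shows "(\<integral>\<^sup>+x. g x \<partial>mixture_law n \<psi>) =
    (\<integral>\<^sup>+p. \<integral>\<^sup>+q. g ((picks ({1..n} - {i}) p)(i := pick (fst p) q)) \<partial>site \<psi> \<partial>sites ({1..n} - {i}) \<psi>)"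
proof -
  define I where "I = {1..n} - {i}"
  have ins: "{1..n} = insert i I" "i \<notin> I" "finite I" using i by (auto simp: I_def)
  interpret S: prob_space "site \<psi>" by (rule prob_space_site)
  interpret PS: product_sigma_finite "\<lambda>_::nat. site \<psi>" by standard
  interpret F: prob_space "PiM J (\<lambda>_. site \<psi>)" for J :: "nat set"
    by (intro prob_space_PiM prob_space_site)
  have g' [measurable]: "g \<in> borel_measurable (PiM (insert i I) (\<lambda>_. unit_interval))"
    using g unfolding ins .
  have pm [measurable]: "picks (insert i I) \<in> measurable (unif \<Otimes>\<^sub>M PiM (insert i I) (\<lambda>_. site \<psi>)) (PiM (insert i I) (\<lambda>_. unit_interval))"
    using measurable_picks[of "insert i I"] unfolding sites_def .
  have pmI [measurable]: "picks I \<in> measurable (unif \<Otimes>\<^sub>M PiM I (\<lambda>_. site \<psi>)) (PiM I (\<lambda>_. unit_interval))"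
    using measurable_picks[of I] unfolding sites_def .
  have upd: "picks (insert i I) (x, fun_upd \<omega> i q) = (picks I (x, \<omega>))(i := pick x q)" for x \<omega> q
    using ins(2) by (auto simp: picks_def fun_eq_iff)
  have "(\<integral>\<^sup>+x. g x \<partial>mixture_law n \<psi>) = (\<integral>\<^sup>+p. g (picks (insert i I) p) \<partial>sites (insert i I) \<psi>)"
    unfolding mixture_law_eq ins by (intro nn_integral_distr) measurable
  also have "\<dots> = (\<integral>\<^sup>+x. \<integral>\<^sup>+\<omega>. g (picks (insert i I) (x, \<omega>)) \<partial>PiM (insert i I) (\<lambda>_. site \<psi>) \<partial>unif)"
    unfolding sites_def by (intro F.nn_integral_fst[symmetric]) measurable
  also have "\<dots> = (\<integral>\<^sup>+x. \<integral>\<^sup>+\<omega>. \<integral>\<^sup>+q. g ((picks I (x, \<omega>))(i := pick x q)) \<partial>site \<psi>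
      \<partial>PiM I (\<lambda>_. site \<psi>) \<partial>unif)"
    using ins(2,3)
    by (intro nn_integral_cong) (subst PS.product_nn_integral_insert, simp_all add: upd)
  also have "\<dots> = (\<integral>\<^sup>+p. \<integral>\<^sup>+q. g ((picks I p)(i := pick (fst p) q)) \<partial>site \<psi> \<partial>sites I \<psi>)"
    unfolding sites_def by (subst F.nn_integral_fst[symmetric]) (simp_all cong: if_cong)
  finally show ?thesis unfolding I_def .
qed

section \<open>The conditional law of the hidden value given a configuration\<close>

text \<open>
  The partition is by the set \<open>T\<close> of sites that copy \<open>x\<^sup>*\<close>: if \<open>T\<close> is nonempty then \<open>x\<^sup>*\<close> can be
  read off at any site of \<open>T\<close>, and otherwise \<open>x\<^sup>*\<close> is independent of the configuration.
\<close>

lemma sites_disintegration: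
  assumes I: "finite I"
  obtains \<rho> where "\<rho> \<in> measurable (PiM I (\<lambda>_. unit_interval)) (prob_algebra unit_interval)"
    and "\<And>A B. A \<in> sets (PiM I (\<lambda>_. unit_interval)) \<Longrightarrow> B \<in> sets unit_interval \<Longrightarrow>
       (\<integral>\<^sup>+p. indicator A (picks I p) * indicator B (fst p) \<partial>sites I \<psi>) =
       (\<integral>\<^sup>+p. indicator A (picks I p) * emeasure (\<rho> (picks I p)) B \<partial>sites I \<psi>)"
proof -
  define E where "E T = {p \<in> space (sites I \<psi>). {j\<in>I. fst (snd p j)} = T}" for T
  \<comment> \<open>Which site of \<open>T\<close> is chosen does not matter: on \<open>E T\<close>
    they all carry the value \<open>x\<^sup>*\<close>.\<close>
  define R where "R T y = (if T = {} then unif else return unit_interval (y (SOME t. t \<in> T)))"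
    for T and y :: "nat \<Rightarrow> real"
  have some: "(SOME t. t \<in> T) \<in> T" if "T \<noteq> {}" for T :: "nat set"
    using that by (simp add: some_in_eq)
  interpret U: prob_space unif by (rule prob_space_unif)
  interpret F: prob_space "PiM I (\<lambda>_. site \<psi>)"
    by (intro prob_space_PiM prob_space_site)
  have X [measurable]: "fst \<in> measurable (sites I \<psi>) unit_interval"
    unfolding sites_def by measurable
  have E_sets: "E T \<in> sets (sites I \<psi>)" if "T \<in> Pow I" for T
  proof -
    \<comment> \<open>For \<open>T\<close> inside \<open>I\<close>, equality of the two sets becomes
      finitely many conditions on single coins, which is measurable.\<close>
    have "E T = {p \<in> space (sites I \<psi>). \<forall>j\<in>I. fst (snd p j) = (j \<in> T)}"
      using that by (auto simp: E_def)
    also have "\<dots> \<in> sets (sites I \<psi>)"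
      unfolding sites_def using I by measurable
    finally show ?thesis .
  qed
  have R_meas: "R T \<in> measurable (PiM I (\<lambda>_. unit_interval)) (prob_algebra unit_interval)"
    if "T \<in> Pow I" for T
  proof (cases "T = {}")
    case True
    then show ?thesis using unif_in_prob_algebra by (simp add: R_def[abs_def])
  next
    case False
    then have "(SOME t. t \<in> T) \<in> I" using some that by blast
    from measurable_compose[OF measurable_component_singleton[OF this] measurable_return_prob_space]
    show ?thesis using False by (simp add: R_def[abs_def])
  qed
  show thesis
  proof (rule disintegration_finite_partition[OF prob_space_sites measurable_picks X, where K = "Pow I" and E = E and R = R])
    show "finite (Pow I)" using I by simp
    show "(\<Sum>T\<in>Pow I. indicator (E T) p) = (1::ennreal)" if "p \<in> space (sites I \<psi>)" for p
    proof -
      have "(\<Sum>T\<in>Pow I. indicator (E T) p) = (\<Sum>T\<in>Pow I. if {j\<in>I. fst (snd p j)} = T then 1 else (0::ennreal))"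
        using that by (intro sum.cong) (auto simp: E_def indicator_def)
      also have "\<dots> = 1" using I by (subst sum.delta') auto
      finally show ?thesis .
    qed
    fix T A B assume T: "T \<in> Pow I" and A [measurable]: "A \<in> sets (PiM I (\<lambda>_. unit_interval))"
      and B [measurable]: "B \<in> sets unit_interval"
    show "(\<integral>\<^sup>+p. indicator (E T) p * (indicator A (picks I p) * indicator B (fst p)) \<partial>sites I \<psi>) =
       (\<integral>\<^sup>+p. indicator (E T) p * (indicator A (picks I p) * emeasure (R T (picks I p)) B) \<partial>sites I \<psi>)"
    proof (cases "T = {}")
      case False
      then have s: "(SOME t. t \<in> T) \<in> T" by (rule some)
      \<comment> \<open>The integrands agree pointwise: on \<open>E T\<close> the coordinate read by
        \<open>R T\<close> equals \<open>fst p\<close>, so the point mass there evaluates to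
        \<open>indicator B (fst p)\<close>; off \<open>E T\<close> both sides vanish.\<close>
      show ?thesis
      proof (intro nn_integral_cong)
        fix p assume "p \<in> space (sites I \<psi>)"
        show "indicator (E T) p * (indicator A (picks I p) * indicator B (fst p)) =
          indicator (E T) p * (indicator A (picks I p) * emeasure (R T (picks I p)) B)"
        proof (cases "p \<in> E T")
          case True
          then have "picks I p (SOME t. t \<in> T) = fst p"
            using s T by (auto simp: E_def picks_def)
          then show ?thesis using False B by (simp add: R_def)
        qed simp
      qed
    next
      case True
      then have RT: "R T y = unif" for y by (simp add: R_def)
      \<comment> \<open>When no site copies, the configuration is the vector \<open>z\<close> of
        fresh values. Thus \<open>h\<close> collects all factors other than
        \<open>indicator B (fst p)\<close> and depends on the sites alone.\<close>
      define z where "z \<omega> = (\<lambda>j\<in>I. snd (\<omega> j))" for \<omega> :: "nat \<Rightarrow> bool \<times> real"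
      define h :: "(nat \<Rightarrow> bool \<times> real) \<Rightarrow> ennreal"
        where "h \<omega> = (if \<forall>j\<in>I. \<not> fst (\<omega> j) then indicator A (z \<omega>) else 0)" for \<omega>
      have [measurable]: "z \<in> measurable (PiM I (\<lambda>_. site \<psi>)) (PiM I (\<lambda>_. unit_interval))"
        unfolding z_def by measurable
      have h [measurable]: "h \<in> borel_measurable (PiM I (\<lambda>_. site \<psi>))"
        unfolding h_def using I by measurable
      have hp: "indicator (E T) p * indicator A (picks I p) = h (snd p)"
        if "p \<in> space (sites I \<psi>)" for p
      proof (cases "\<forall>j\<in>I. \<not> fst (snd p j)")
        case neg: True
        then have "picks I p = z (snd p)"
          by (auto simp: picks_def z_def fun_eq_iff restrict_def)
        moreover have "p \<in> E T" using neg that True by (auto simp: E_def)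
        ultimately show ?thesis using neg by (simp add: h_def)
      next
        case False
        then have "p \<notin> E T" using True by (auto simp: E_def)
        then show ?thesis using False by (auto simp: h_def)
      qed
      \<comment> \<open>Independence of \<open>x\<^sup>*\<close> and the sites. Applied once to
        \<open>indicator B\<close> and once to the constant \<open>emeasure unif B\<close>, it shows
        that the first may be replaced by the second.\<close>
      have prod: "(\<integral>\<^sup>+p. h (snd p) * k (fst p) \<partial>sites I \<psi>) = integral\<^sup>N (PiM I (\<lambda>_. site \<psi>)) h * integral\<^sup>N unif k"
        if [measurable]: "k \<in> borel_measurable unif" for k
        unfolding sites_def
        by (subst F.nn_integral_fst[symmetric])
           (simp_all add: nn_integral_multc nn_integral_cmult mult.commute)
      have "(\<integral>\<^sup>+p. indicator (E T) p * (indicator A (picks I p) * indicator B (fst p)) \<partial>sites I \<psi>)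
          = (\<integral>\<^sup>+p. h (snd p) * indicator B (fst p) \<partial>sites I \<psi>)"
        by (intro nn_integral_cong) (simp add: hp mult.assoc[symmetric])
      also have "\<dots> = integral\<^sup>N (PiM I (\<lambda>_. site \<psi>)) h * emeasure unif B"
        by (subst prod) (simp_all add: sets_unif)
      also have "\<dots> = (\<integral>\<^sup>+p. h (snd p) * emeasure unif B \<partial>sites I \<psi>)"
        by (subst prod) (simp_all add: U.emeasure_space_1)
      also have "\<dots> = (\<integral>\<^sup>+p. indicator (E T) p * (indicator A (picks I p) * emeasure (R T (picks I p)) B) \<partial>sites I \<psi>)"
        by (intro nn_integral_cong) (simp add: hp mult.assoc[symmetric] RT)
      finally show ?thesis .
    qed
  qed (use E_sets R_meas that in auto)
qed

section \<open>The one-coordinate marginals\<close>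

text \<open>Both outcomes of the coin yield a uniform value, since \<open>x\<^sup>*\<close> is
  itself uniform; the weights \<psi> and 1 - \<psi> add up to 1.\<close>

lemma marginal_mixture_law:
  assumes \<psi>: "0 \<le> \<psi>" "\<psi> \<le> 1" and i: "i \<in> {1..n}"
  shows "marginal unit_interval (mixture_law n \<psi>) i = unif"
proof (rule measure_eqI)
  define I where "I = {1..n} - {i}"
  interpret U: prob_space unif by (rule prob_space_unif)
  interpret F: prob_space "PiM I (\<lambda>_. site \<psi>)"
    by (intro prob_space_PiM prob_space_site)
  show "sets (marginal unit_interval (mixture_law n \<psi>) i) = sets unif"
    by (simp add: marginal_def sets_unif)
  fix B assume "B \<in> sets (marginal unit_interval (mixture_law n \<psi>) i)"
  then have B [measurable]: "B \<in> sets unit_interval" by (simp add: marginal_def)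
  have unif: "(\<integral>\<^sup>+x. ennreal \<psi> * indicator B x + ennreal (1 - \<psi>) * emeasure unif B \<partial>unif) = emeasure unif B"
  proof -
    have "(\<integral>\<^sup>+x. ennreal \<psi> * indicator B x + ennreal (1 - \<psi>) * emeasure unif B \<partial>unif) =
      (ennreal \<psi> + ennreal (1 - \<psi>)) * emeasure unif B"
      by (subst nn_integral_add, measurable, subst nn_integral_cmult, measurable)
         (simp add: U.emeasure_space_1 sets_unif distrib_right)
    then show ?thesis using \<psi> by (simp flip: ennreal_plus)
  qed
  have [measurable]: "(\<lambda>x. x i) \<in> measurable (pow_space unit_interval n) unit_interval"
    using i by (rule measurable_component_singleton)
  then have comp: "(\<lambda>x. x i) \<in> measurable (mixture_law n \<psi>) unit_interval"
    by (subst measurable_cong_sets[OF sets_mixture_law refl])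
  have "emeasure (marginal unit_interval (mixture_law n \<psi>) i) B =
    (\<integral>\<^sup>+x. indicator B x \<partial>marginal unit_interval (mixture_law n \<psi>) i)"
    by (simp add: marginal_def)
  also have "\<dots> = (\<integral>\<^sup>+x. indicator B (x i) \<partial>mixture_law n \<psi>)"
    unfolding marginal_def by (rule nn_integral_distr[OF comp]) (simp add: B)
  also have "\<dots> = (\<integral>\<^sup>+p. \<integral>\<^sup>+q. indicator B (pick (fst p) q) \<partial>site \<psi> \<partial>sites I \<psi>)"
    using i unfolding I_def by (subst nn_integral_mixture_law[OF i]) simp_all
  also have "\<dots> = (\<integral>\<^sup>+p. ennreal \<psi> * indicator B (fst p) + ennreal (1 - \<psi>) * emeasure unif B \<partial>sites I \<psi>)"
    using nn_integral_pick[OF \<psi> B]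
    by (intro nn_integral_cong) (auto simp: sites_def space_pair_measure)
  also have "\<dots> = (\<integral>\<^sup>+x. ennreal \<psi> * indicator B x + ennreal (1 - \<psi>) * emeasure unif B \<partial>unif)"
    unfolding sites_def by (subst F.nn_integral_fst[symmetric]) (simp_all add: F.emeasure_space_1)
  also note unif
  finally show "emeasure (marginal unit_interval (mixture_law n \<psi>) i) B = emeasure unif B" .
qed

section \<open>Total variation distance to a mixture and the conditional kernels\<close>

text \<open>The common component cancels: on every event \<open>P - Q\<close> equals \<psi> times
  \<open>P - Q'\<close>, and two probabilities differ by at most 1.\<close>

lemma tv_dist_mixture_le:
  assumes P: "prob_space P" and Q: "prob_space Q" and Q': "prob_space Q'"
    and sets: "sets P = sets Q" "sets P = sets Q'"
    and \<psi>: "0 \<le> \<psi>" "\<psi> \<le> 1"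
    and mix: "\<And>B. B \<in> sets P \<Longrightarrow> emeasure Q B = ennreal \<psi> * emeasure Q' B + ennreal (1 - \<psi>) * emeasure P B"
  shows "tv_dist P Q \<le> \<psi>"
  unfolding tv_dist_def
proof (rule cSUP_least)
  interpret P: prob_space P by (rule P)
  interpret Q: prob_space Q by (rule Q)
  interpret Q': prob_space Q' by (rule Q')
  fix B assume B: "B \<in> sets P"
  have "ennreal (measure Q B) = ennreal (\<psi> * measure Q' B + (1 - \<psi>) * measure P B)"
    using mix[OF B] \<psi>
    by (simp add: P.emeasure_eq_measure Q.emeasure_eq_measure Q'.emeasure_eq_measure
        ennreal_mult ennreal_plus)
  then have "measure Q B = \<psi> * measure Q' B + (1 - \<psi>) * measure P B"
    using \<psi> by (subst (asm) ennreal_inj) auto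
  then have "measure P B - measure Q B = \<psi> * (measure P B - measure Q' B)"
    by (simp add: algebra_simps)
  then have "\<bar>measure P B - measure Q B\<bar> = \<psi> * \<bar>measure P B - measure Q' B\<bar>"
    using \<psi>(1) by (simp add: abs_mult)
  also have "\<dots> \<le> \<psi> * 1"
    using P.prob_le_1[of B] Q'.prob_le_1[of B] measure_nonneg[of P B] measure_nonneg[of Q' B] \<psi>(1)
    by (intro mult_left_mono) linarith+
  finally show "\<bar>measure P B - measure Q B\<bar> \<le> \<psi>" by simp
qed auto

text \<open>The version is chosen as the mixture of \<open>\<rho>\<close> and the uniform law at
  every point of the space, so the bound on the distance has no exceptional set. That it
  disintegrates the law follows by integrating out site \<open>i\<close> and then disintegrating
  \<open>x\<^sup>*\<close> given the other sites.\<close>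

lemma mixture_law_cond_version:
  assumes \<psi>: "0 \<le> \<psi>" "\<psi> \<le> 1" and i: "i \<in> {1..n}"
  obtains \<kappa> where "cond_version unit_interval n (mixture_law n \<psi>) i \<kappa>"
    and "\<And>y. y \<in> space (PiM ({1..n} - {i}) (\<lambda>_. unit_interval)) \<Longrightarrow> tv_dist unif (\<kappa> y) \<le> \<psi>"
proof -
  define I where "I = {1..n} - {i}"
  define N where "N = PiM I (\<lambda>_. unit_interval)"
  define \<mu> where "\<mu> = mixture_law n \<psi>"
  have I: "finite I" "i \<notin> I" by (auto simp: I_def)
  interpret S: prob_space "site \<psi>" by (rule prob_space_site)
  have picks_N [measurable]: "picks I \<in> measurable (sites I \<psi>) N"
    unfolding N_def by measurable
  have fst_unit [measurable]: "fst \<in> measurable (sites I \<psi>) unit_interval"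
    unfolding sites_def by measurable
  obtain \<rho> where \<rho>: "\<rho> \<in> measurable N (prob_algebra unit_interval)"
    and dis: "\<And>A B. A \<in> sets N \<Longrightarrow> B \<in> sets unit_interval \<Longrightarrow>
       (\<integral>\<^sup>+p. indicator A (picks I p) * indicator B (fst p) \<partial>sites I \<psi>) =
       (\<integral>\<^sup>+p. indicator A (picks I p) * emeasure (\<rho> (picks I p)) B \<partial>sites I \<psi>)"
    using sites_disintegration[OF I(1), of \<psi>] unfolding N_def by blast
  \<comment> \<open>The index of the mixture is the coin at site \<open>i\<close>: heads copies
    \<open>x\<^sup>*\<close>, whose conditional law is \<open>\<rho>\<close>; tails draws a fresh
    uniform value.\<close>
  define R where "R b = (if b then \<rho> else (\<lambda>_. unif))" for b
  have R: "R b \<in> measurable N (prob_algebra unit_interval)" for b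
    using \<rho> unif_in_prob_algebra by (simp add: R_def)
  obtain \<kappa> where \<kappa>: "\<kappa> \<in> measurable N (prob_algebra unit_interval)"
    and em': "\<And>y B. y \<in> space N \<Longrightarrow> B \<in> sets unit_interval \<Longrightarrow>
       emeasure (\<kappa> y) B = (\<Sum>b\<in>UNIV. ennreal (if b then \<psi> else 1 - \<psi>) * emeasure (R b y) B)"
  proof (rule kernel_finite_mixture[of UNIV "\<lambda>b _. ennreal (if b then \<psi> else 1 - \<psi>)" N R unit_interval])
    show "(\<Sum>b\<in>UNIV. ennreal (if b then \<psi> else 1 - \<psi>)) = 1"
      using \<psi> by (simp add: UNIV_bool flip: ennreal_plus)
  qed (use R in auto)
  have em: "emeasure (\<kappa> y) B = ennreal \<psi> * emeasure (\<rho> y) B + ennreal (1 - \<psi>) * emeasure unif B"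
    if "y \<in> space N" "B \<in> sets unit_interval" for y B
    using em'[OF that] by (simp add: UNIV_bool R_def add.commute)
  have prob: "prob_space (K y)" "sets (K y) = sets unit_interval"
    if "K \<in> measurable N (prob_algebra unit_interval)" "y \<in> space N" for K y
    using measurable_space[OF that] by (auto simp: space_prob_algebra)
  show thesis
  proof
    fix y assume "y \<in> space (PiM ({1..n} - {i}) (\<lambda>_. unit_interval))"
    then have y: "y \<in> space N" by (simp add: N_def I_def)
    show "tv_dist unif (\<kappa> y) \<le> \<psi>"
      using prob(2)[OF \<kappa> y] prob(2)[OF \<rho> y] \<psi> em[OF y]
      by (intro tv_dist_mixture_le[OF prob_space_unif prob(1)[OF \<kappa> y] prob(1)[OF \<rho> y]])
         (simp_all add: sets_unif)
  next
    have drop [measurable]: "drop_coord n i \<in> measurable (pow_space unit_interval n) N"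
      unfolding drop_coord_def[abs_def] N_def I_def by (rule measurable_restrict_subset) auto
    \<comment> \<open>The discarded coordinate is the one integrated innermost, so functions of the
      remaining coordinates are constants for the inner integral.\<close>
    have drop_upd: "drop_coord n i ((picks I p)(i := a)) = picks I p" for p a
      by (auto simp: drop_coord_def picks_def I_def fun_eq_iff)
    have comp [measurable]: "(\<lambda>x. x i) \<in> measurable (pow_space unit_interval n) unit_interval"
      using i by (rule measurable_component_singleton)
    have [measurable_cong]: "sets \<mu> = sets (pow_space unit_interval n)"
      unfolding \<mu>_def by (rule sets_mixture_law)
    have "emeasure \<mu> {x \<in> space \<mu>. drop_coord n i x \<in> A \<and> x i \<in> B} =
        (\<integral>\<^sup>+x. indicator A (drop_coord n i x) * emeasure (\<kappa> (drop_coord n i x)) B \<partial>\<mu>)"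
      if A [measurable]: "A \<in> sets N" and B [measurable]: "B \<in> sets unit_interval" for A B
    proof -
      have [measurable]: "(\<lambda>y. emeasure (K y) B) \<in> borel_measurable N"
        if "K \<in> measurable N (prob_algebra unit_interval)" for K
        using measurable_emeasure_kernel[OF measurable_prob_algebraD[OF that] B] .
      note [measurable] = this[OF \<kappa>] this[OF \<rho>]
      have y: "picks I p \<in> space N" if "p \<in> space (sites I \<psi>)" for p
        using measurable_space[OF picks_N that] .
      have "emeasure \<mu> {x \<in> space \<mu>. drop_coord n i x \<in> A \<and> x i \<in> B} =
        (\<integral>\<^sup>+x. indicator A (drop_coord n i x) * indicator B (x i) \<partial>\<mu>)"
        by (subst nn_integral_indicator[symmetric], measurable)
           (intro nn_integral_cong, auto simp: indicator_def)
      also have "\<dots> = (\<integral>\<^sup>+p. \<integral>\<^sup>+q. indicator A (picks I p) * indicator B (pick (fst p) q) \<partial>site \<psi> \<partial>sites I \<psi>)"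
        unfolding \<mu>_def by (subst nn_integral_mixture_law[OF i], measurable)
          (simp add: I_def[symmetric] drop_upd del: One_nat_def)
      also have "\<dots> = (\<integral>\<^sup>+p. ennreal \<psi> * (indicator A (picks I p) * indicator B (fst p))
           + ennreal (1 - \<psi>) * emeasure unif B * indicator A (picks I p) \<partial>sites I \<psi>)"
      proof (intro nn_integral_cong)
        fix p assume "p \<in> space (sites I \<psi>)"
        then have x: "fst p \<in> space unif" by (auto simp: sites_def space_pair_measure)
        then have [measurable]: "fst p \<in> space unit_interval"
          using sets_eq_imp_space_eq[OF sets_unif] by simp
        have "(\<integral>\<^sup>+q. indicator A (picks I p) * indicator B (pick (fst p) q) \<partial>site \<psi>) =
          indicator A (picks I p) * (\<integral>\<^sup>+q. indicator B (pick (fst p) q) \<partial>site \<psi>)"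
          by (intro nn_integral_cmult) measurable
        then show "(\<integral>\<^sup>+q. indicator A (picks I p) * indicator B (pick (fst p) q) \<partial>site \<psi>) =
          ennreal \<psi> * (indicator A (picks I p) * indicator B (fst p))
           + ennreal (1 - \<psi>) * emeasure unif B * indicator A (picks I p)"
          by (simp add: nn_integral_pick[OF \<psi> B x] algebra_simps)
      qed
      \<comment> \<open>Only the first summand involves \<open>x\<^sup>*\<close>; there
        \<open>dis\<close> trades its indicator for \<open>\<rho>\<close>, and the integrand becomes
        the mixture defining \<open>\<kappa>\<close>.\<close>
      also have "\<dots> = (\<integral>\<^sup>+p. ennreal \<psi> * (indicator A (picks I p) * emeasure (\<rho> (picks I p)) B)
           + ennreal (1 - \<psi>) * emeasure unif B * indicator A (picks I p) \<partial>sites I \<psi>)"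
        by (simp add: nn_integral_add nn_integral_cmult dis)
      also have "\<dots> = (\<integral>\<^sup>+p. indicator A (picks I p) * emeasure (\<kappa> (picks I p)) B \<partial>sites I \<psi>)"
        by (intro nn_integral_cong) (simp add: em y algebra_simps)
      \<comment> \<open>The same Fubini formula read backwards: the inner integrand does not depend
        on \<open>q\<close>, and a site has total mass 1.\<close>
      also have "\<dots> = (\<integral>\<^sup>+x. indicator A (drop_coord n i x) * emeasure (\<kappa> (drop_coord n i x)) B \<partial>\<mu>)"
        unfolding \<mu>_def
        by (subst nn_integral_mixture_law[OF i], measurable)
          (simp add: I_def[symmetric] drop_upd S.emeasure_space_1 del: One_nat_def)
      finally show ?thesis .
    qed
    then show "cond_version unit_interval n (mixture_law n \<psi>) i \<kappa>"
      using \<kappa> unfolding cond_version_def by (simp add: N_def I_def \<mu>_def)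
  qed
qed

section \<open>Averaging over the coordinates\<close>

theorem lemma3p3:
  fixes \<psi> :: real and n :: nat
  assumes "0 \<le> \<psi>" and "\<psi> \<le> 1" and "1 \<le> n"
  shows "gibbs_dependence unit_interval n (mixture_law n \<psi>) \<psi>"
proof -
  define \<mu> where "\<mu> = mixture_law n \<psi>"
  have "\<forall>i\<in>{1..n}. \<exists>\<kappa>. cond_version unit_interval n \<mu> i \<kappa> \<and>
    (\<forall>y\<in>space (PiM ({1..n} - {i}) (\<lambda>_. unit_interval)). tv_dist unif (\<kappa> y) \<le> \<psi>)"
    using mixture_law_cond_version[OF assms(1,2)] unfolding \<mu>_def by metis
  then obtain \<kappa> where \<kappa>: "\<And>i. i \<in> {1..n} \<Longrightarrow> cond_version unit_interval n \<mu> i (\<kappa> i)"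
    and tv: "\<And>i y. i \<in> {1..n} \<Longrightarrow> y \<in> space (PiM ({1..n} - {i}) (\<lambda>_. unit_interval)) \<Longrightarrow>
       tv_dist unif (\<kappa> i y) \<le> \<psi>"
    by metis
  have "gibbs_coeff unit_interval n \<mu> \<kappa> \<le> \<psi>"
    unfolding gibbs_coeff_def
  proof (rule cSUP_least)
    show "space (pow_space unit_interval n) \<noteq> {}"
      by (auto simp: space_PiM PiE_eq_empty_iff unit_interval_def space_restrict_space)
    fix x assume x: "x \<in> space (pow_space unit_interval n)"
    let ?d = "\<lambda>i. tv_dist (marginal unit_interval \<mu> i) (\<kappa> i (drop_coord n i x))"
    have "?d i \<le> \<psi>" if i: "i \<in> {1..n}" for i
    proof -
      \<comment> \<open>Every \<open>x\<close> restricts to a point where \<open>tv\<close> applies,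
        so each term is bounded for all \<open>x\<close>, as the supremum demands.\<close>
      have "drop_coord n i x \<in> space (PiM ({1..n} - {i}) (\<lambda>_. unit_interval))"
        using x by (auto simp: drop_coord_def space_PiM PiE_def Pi_def)
      then show ?thesis
        using tv[OF i] marginal_mixture_law[OF assms(1,2) i] by (simp add: \<mu>_def)
    qed
    then have "(\<Sum>i\<in>{1..n}. ?d i) \<le> real n * \<psi>"
      using sum_bounded_above[of "{1..n}" ?d \<psi>] by simp
    \<comment> \<open>Since \<open>1 \<le> n\<close>, the index set is inhabited and the expectation
      is the arithmetic mean of the \<open>n\<close> terms.\<close>
    then show "measure_pmf.expectation (pmf_of_set {1..n}) ?d \<le> \<psi>"
      using assms(3) by (subst integral_pmf_of_set) (auto simp: field_simps)
  qed
  moreover have "\<mu> \<in> space (prob_algebra (pow_space unit_interval n))"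
    unfolding \<mu>_def mixture_law_eq
    by (auto simp: space_prob_algebra intro!: prob_space.prob_space_distr prob_space_sites)
  ultimately show ?thesis
    using \<kappa> unfolding gibbs_dependence_def \<mu>_def by blast
qed

end
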